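(* Let $U,L\in\mathbb{R}^{n_x}$ be constant vectors such that for any $x\in X_{LF}$ and any $\lambda\in\mathbb{R}^{n_x}$ satisfying, for all $i$, $\lambda_i\ge U_i$ if $x_i=1$ and $\lambda_i\le L_i$ if $x_i=0$, one has $\phi(x)=L_\ell(x,\lambda)$. Put $\hat\lambda(x):=U\odot(\mathbf 1-x)+L\odot x$. (a) For any $z\in[0,1]^{n_x}$, the inequality $$d_\ell^\top y\ge\psi(z)-(\hat\lambda(\mathbf 1-x))^\top(x-z)$$ holds for every $(x,y)\in X_{LF}\times Y$ satisfying $d_\ell^\top y\ge\phi(x)$. (b) If $z\in\{0,1\}^{n_x}$, this inequality can be rewritten (for $x\in\{0,1\}^{n_x}$) as $$d_\ell^\top y\ge\phi(z)-(\hat\lambda(z))^\top(x-z)$$ and is valid and tight for $d_\ell^\top y\ge\phi(x)$: its right-hand side is at most $\phi(x)$ for every $x\in X_{LF}$, and equals $\phi(x)$ at $x=z$.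
   Context: $Y\subseteq\mathbb{R}^{n_y}$, $d_\ell\in\mathbb{R}^{n_y}$, $A_\ell\in\mathbb{R}^{m_\ell\times n_x}$, $B_\ell\in\mathbb{R}^{m_\ell\times n_y}$, $h_\ell\in\mathbb{R}^{m_\ell}$; $\mathbf 1$ is the all-ones vector and $\odot$ the entrywise (Hadamard) product. For $x\in X=\{0,1\}^{n_x}$, $\phi(x)=\max\{d_\ell^\top y' : y'\in Y,\ B_\ell y'\le h_\ell-A_\ell x\}$, equal to $-\infty$ when infeasible and real-valued (attained) otherwise. $X_{LF}=\{x\in\{0,1\}^{n_x}:\exists y'\in Y,\ B_\ell y'\le h_\ell-A_\ell x\}$. $\psi:[0,1]^{n_x}\to\mathbb{R}\cup\{-\infty\}$ is the extension of $\phi$ that is affine in each individual coordinate, $\psi(z)=\sum_{x\in\{0,1\}^{n_x}}\phi(x)\prod_{i:x_i=1}z_i\prod_{i:x_i=0}(1-z_i)$, with $0\cdot(-\infty)=0$. For $x\in\{0,1\}^{n_x}$ and $\lambda\in\mathbb{R}^{n_x}$, $L_\ell(x,\lambda)=\max_{z\in[0,1]^{n_x}}\psi(z)-\lambda^\top(x-z)$. *)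

theory Defs
  imports "HOL-Analysis.Analysis"
begin

text \<open>
  On \<^typ>\<open>real^'n\<close> the library's order and multiplication are componentwise and \<open>1\<close> is the
  all-ones vector, so \<open>u * v\<close> is the Hadamard product and \<open>{0..1}\<close> is the unit cube.
\<close>

definition binary_points :: "(real^'n) set" where
  "binary_points = {x. \<forall>i. x $ i = 0 \<or> x $ i = 1}"

lemma finite_binary_points: "finite (binary_points :: (real^'n) set)"
proof -
  have "binary_points \<subseteq> range (\<lambda>S. (\<chi> i. if i \<in> S then 1 else 0) :: real^'n)"
  proof
    fix x :: "real^'n" assume "x \<in> binary_points"
    then have "x = (\<chi> i. if i \<in> {i. x $ i = 1} then 1 else 0)"
      by (auto simp: binary_points_def vec_eq_iff)
    then show "x \<in> range (\<lambda>S. (\<chi> i. if i \<in> S then 1 else 0) :: real^'n)"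
      by blast
  qed
  then show ?thesis
    by (rule finite_subset) simp
qed

definition follower_feasible ::
  "(real^'ny) set \<Rightarrow> real^'nx^'m \<Rightarrow> real^'ny^'m \<Rightarrow> real^'m \<Rightarrow> real^'nx \<Rightarrow> (real^'ny) set" where
  "follower_feasible Y A B h x = {y' \<in> Y. B *v y' \<le> h - A *v x}"

text \<open>
  The supremum of the empty set in \<^typ>\<open>ereal\<close> is \<open>-\<infinity>\<close>, the value for infeasible \<open>x\<close>;
  under \<open>follower_attained\<close> the supremum over a nonempty feasible set is a maximum.
\<close>

definition follower_value ::
  "(real^'ny) set \<Rightarrow> real^'ny \<Rightarrow> real^'nx^'m \<Rightarrow> real^'ny^'m \<Rightarrow> real^'m \<Rightarrow> real^'nx \<Rightarrow> ereal" where
  "follower_value Y d A B h x = (SUP y' \<in> follower_feasible Y A B h x. ereal (d \<bullet> y'))"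

definition follower_attained ::
  "(real^'ny) set \<Rightarrow> real^'ny \<Rightarrow> real^'nx^'m \<Rightarrow> real^'ny^'m \<Rightarrow> real^'m \<Rightarrow> bool" where
  "follower_attained Y d A B h \<longleftrightarrow>
    (\<forall>x \<in> binary_points. follower_feasible Y A B h x \<noteq> {} \<longrightarrow>
      (\<exists>y \<in> follower_feasible Y A B h x. \<forall>y' \<in> follower_feasible Y A B h x. d \<bullet> y' \<le> d \<bullet> y))"

definition X_LF ::
  "(real^'ny) set \<Rightarrow> real^'nx^'m \<Rightarrow> real^'ny^'m \<Rightarrow> real^'m \<Rightarrow> (real^'nx) set" where
  "X_LF Y A B h = {x \<in> binary_points. \<exists>y' \<in> Y. B *v y' \<le> h - A *v x}"

text \<open>Multiplication on \<^typ>\<open>ereal\<close> satisfies \<open>0 * (-\<infinity>) = 0\<close>, as the extension requires.\<close>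

definition multilinear_ext :: "(real^'n \<Rightarrow> ereal) \<Rightarrow> real^'n \<Rightarrow> ereal" where
  "multilinear_ext f z =
    (\<Sum>x \<in> binary_points. f x *
      ereal ((\<Prod>i \<in> {i. x $ i = 1}. z $ i) * (\<Prod>i \<in> {i. x $ i = 0}. 1 - z $ i)))"

text \<open>
  For \<open>f\<close> with values below \<open>\<infinity>\<close> the objective is affine in each coordinate of \<open>z\<close>, so the
  supremum is attained, at a binary point.
\<close>

definition lagrangian :: "(real^'n \<Rightarrow> ereal) \<Rightarrow> real^'n \<Rightarrow> real^'n \<Rightarrow> ereal" where
  "lagrangian f x lam = (SUP z \<in> {0..1}. multilinear_ext f z - ereal (lam \<bullet> (x - z)))"

definition lam_hat :: "real^'n \<Rightarrow> real^'n \<Rightarrow> real^'n \<Rightarrow> real^'n" where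
  "lam_hat U L x = U * (1 - x) + L * x"

end

theory Submission imports Defs begin

text \<open>The multiplier \<open>lam_hat U L (1 - x)\<close> has entry \<open>U $ i\<close> where
  \<open>x $ i = 1\<close> and \<open>L $ i\<close> where \<open>x $ i = 0\<close>, so it meets the
  sign bounds in \<open>UL\<close> with equality and the Lagrangian at \<open>x\<close> equals the
  follower value. As the Lagrangian is a supremum over the cube, each \<open>z\<close> in the cube
  gives a lower bound on that value, which is (a). For (b), a binary \<open>z\<close> lies in the
  cube, the extension agrees there with the follower value (\<open>multilinear_ext_binary\<close>),
  and the multiplier may be replaced by one depending only on \<open>z\<close>
  (\<open>lam_hat_complement_inner\<close>). At \<open>x = z\<close> the linear term vanishes, which
  gives tightness.\<close>

text \<open>At a binary \<open>z\<close> the products weighting the vertices form the indicator of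
  \<open>z\<close>, so a single summand survives.\<close>

lemma multilinear_ext_binary:
  fixes f :: "real^'n \<Rightarrow> ereal"
  assumes z: "z \<in> binary_points"
  shows "multilinear_ext f z = f z"
proof -
  have weight: "(\<Prod>i \<in> {i. x $ i = 1}. z $ i) * (\<Prod>i \<in> {i. x $ i = 0}. 1 - z $ i) =
      (if x = z then 1 else 0)" if x: "x \<in> binary_points" for x
  proof (cases "x = z")
    case True
    then show ?thesis by simp
  next
    case False
    then obtain i where "x $ i \<noteq> z $ i" by (auto simp: vec_eq_iff)
    \<comment> \<open>A coordinate where \<open>x\<close> and \<open>z\<close> differ contributes a
      zero factor to one of the two products.\<close>
    then have "x $ i = 1 \<and> z $ i = 0 \<or> x $ i = 0 \<and> 1 - z $ i = 0"
      using x z unfolding binary_points_def mem_Collect_eq by (metis diff_self)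
    then have "(\<Prod>i \<in> {i. x $ i = 1}. z $ i) = 0 \<or> (\<Prod>i \<in> {i. x $ i = 0}. 1 - z $ i) = 0"
      by (auto simp: prod_zero_iff)
    then show ?thesis using False by auto
  qed
  have "multilinear_ext f z = (\<Sum>x \<in> binary_points. if x = z then f x else 0)"
    unfolding multilinear_ext_def
    \<comment> \<open>Folding \<open>ereal 0\<close> into \<open>0\<close> lets a zero weight
      annihilate infinite values of \<open>f\<close> too.\<close>
    by (intro sum.cong refl) (simp add: weight flip: zero_ereal_def one_ereal_def)
  also have "\<dots> = f z"
    using z by (simp add: finite_binary_points)
  finally show ?thesis .
qed

lemma binary_points_subset_cube: "binary_points \<subseteq> {0..1 :: real^'n}"
proof
  fix x :: "real^'n"
  assume "x \<in> binary_points"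
  then have "0 \<le> x $ i \<and> x $ i \<le> 1" for i
    by (cases "x $ i = 0") (auto simp: binary_points_def)
  then show "x \<in> {0..1}"
    by (simp add: less_eq_vec_def)
qed

text \<open>Where \<open>x\<close> and \<open>z\<close> differ, \<open>1 - x\<close> agrees with \<open>z\<close>; elsewhere \<open>x - z\<close> vanishes.\<close>

lemma lam_hat_complement_inner:
  fixes x z :: "real^'n"
  assumes "x \<in> binary_points" "z \<in> binary_points"
  shows "lam_hat U L (1 - x) \<bullet> (x - z) = lam_hat U L z \<bullet> (x - z)"
  unfolding inner_vec_def
proof (intro sum.cong refl)
  fix i :: 'n
  have "x $ i = 0 \<or> x $ i = 1" "z $ i = 0 \<or> z $ i = 1"
    using assms by (auto simp: binary_points_def)
  then show "lam_hat U L (1 - x) $ i \<bullet> (x - z) $ i = lam_hat U L z $ i \<bullet> (x - z) $ i"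
    by (auto simp: lam_hat_def)
qed

lemma lagrangian_upper:
  "z \<in> {0..1} \<Longrightarrow> multilinear_ext f z - ereal (lam \<bullet> (x - z)) \<le> lagrangian f x lam"
  unfolding lagrangian_def by (rule SUP_upper)

theorem proposition2:
  fixes Y :: "(real^'ny) set" and d :: "real^'ny"
    and A :: "real^'nx^'m" and B :: "real^'ny^'m" and h :: "real^'m"
    and U L :: "real^'nx"
  assumes attained: "follower_attained Y d A B h"
    and UL: "\<And>x lam. x \<in> X_LF Y A B h \<Longrightarrow>
      (\<forall>i. (x $ i = 1 \<longrightarrow> lam $ i \<ge> U $ i) \<and> (x $ i = 0 \<longrightarrow> lam $ i \<le> L $ i)) \<Longrightarrow>
      follower_value Y d A B h x = lagrangian (follower_value Y d A B h) x lam"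
  shows
    "(\<forall>z \<in> {0..1}. \<forall>x \<in> X_LF Y A B h. \<forall>y \<in> Y.
        ereal (d \<bullet> y) \<ge> follower_value Y d A B h x \<longrightarrow>
        ereal (d \<bullet> y) \<ge>
          multilinear_ext (follower_value Y d A B h) z - ereal (lam_hat U L (1 - x) \<bullet> (x - z))) \<and>
     (\<forall>z \<in> binary_points.
        (\<forall>x \<in> binary_points.
          multilinear_ext (follower_value Y d A B h) z - ereal (lam_hat U L (1 - x) \<bullet> (x - z)) =
          follower_value Y d A B h z - ereal (lam_hat U L z \<bullet> (x - z))) \<and>
        (\<forall>x \<in> X_LF Y A B h. \<forall>y \<in> Y.
          ereal (d \<bullet> y) \<ge> follower_value Y d A B h x \<longrightarrow>
          ereal (d \<bullet> y) \<ge> follower_value Y d A B h z - ereal (lam_hat U L z \<bullet> (x - z))) \<and>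
        (\<forall>x \<in> X_LF Y A B h.
          follower_value Y d A B h z - ereal (lam_hat U L z \<bullet> (x - z)) \<le> follower_value Y d A B h x) \<and>
        follower_value Y d A B h z - ereal (lam_hat U L z \<bullet> (z - z)) = follower_value Y d A B h z)"
proof -
  let ?f = "follower_value Y d A B h"
  have cut: "multilinear_ext ?f z - ereal (lam_hat U L (1 - x) \<bullet> (x - z)) \<le> ?f x"
    if z: "z \<in> {0..1}" and x: "x \<in> X_LF Y A B h" for x z
  proof -
    \<comment> \<open>For binary \<open>x\<close>, both bounds in \<open>UL\<close> hold with
      equality for this multiplier.\<close>
    have "?f x = lagrangian ?f x (lam_hat U L (1 - x))"
      using x by (rule UL) (simp add: lam_hat_def)
    then show ?thesis
      using lagrangian_upper[OF z] by simp
  qed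
  have rewritten: "multilinear_ext ?f z - ereal (lam_hat U L (1 - x) \<bullet> (x - z)) =
      ?f z - ereal (lam_hat U L z \<bullet> (x - z))"
    if "z \<in> binary_points" "x \<in> binary_points" for x z
    using that by (simp add: multilinear_ext_binary lam_hat_complement_inner)
  have valid: "?f z - ereal (lam_hat U L z \<bullet> (x - z)) \<le> ?f x"
    if z: "z \<in> binary_points" and x: "x \<in> X_LF Y A B h" for x z
  proof -
    have "x \<in> binary_points"
      using x by (simp add: X_LF_def)
    then show ?thesis
      using cut[of z x] rewritten[OF z] z x binary_points_subset_cube by auto
  qed
  \<comment> \<open>Subtracting zero fixes every extended real, -\<infinity> included, so infeasible
    \<open>z\<close> are covered.\<close>
  have tight: "?f z - ereal (lam_hat U L z \<bullet> (z - z)) = ?f z" for z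
    by (simp flip: zero_ereal_def)
  show ?thesis
    \<comment> \<open>Bounds by \<open>?f x\<close> pass to any \<open>y\<close> with
      \<open>d \<bullet> y\<close> above \<open>?f x\<close> by transitivity.\<close>
    using cut rewritten valid tight by (blast intro: order_trans)
qed

end
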